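(* Let $I \subset \widetilde{I} \subset \mathbb{R}$ be intervals containing $1$ as an interior point. Then the following are equivalent for a function $K : \widetilde{I} \to \mathbb{R}$ that is not identically zero on $\widetilde{I}$. (1) $K$ is multiplicative on $\widetilde{I}$ and Lebesgue measurable on $I$. (2) Either $K \equiv 1$ on $\widetilde{I}$, or $K \equiv \phi_\alpha$ or $K \equiv \psi_\alpha$ on $\widetilde{I}$ for some $\alpha \in \mathbb{R}$.
   Context: A function $K : \widetilde{I} \to \mathbb{R}$ is multiplicative on $\widetilde{I}$ if $K(xy) = K(x)K(y)$ whenever $x, y, xy \in \widetilde{I}$. "$K$ is Lebesgue measurable on $I$" means that the restriction $K|_I$ is Lebesgue measurable. For $\alpha \in \mathbb{R}$, define $\phi_\alpha, \psi_\alpha : \mathbb{R} \to \mathbb{R}$ by $\phi_\alpha(x) := |x|^\alpha$ and $\psi_\alpha(x) := \operatorname{sgn}(x)|x|^\alpha$ for $x \neq 0$, and $\phi_\alpha(0) = \psi_\alpha(0) := 0$ (for every $\alpha$, including $\alpha \le 0$). Intervals may be open, closed, half-open, bounded or unbounded. *)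

theory Defs
  imports "HOL-Analysis.Analysis"
begin

text \<open>A function on a subset of the reals is represented by a total function, of which only the
  values on that subset are ever used.\<close>

definition multiplicative_on :: "real set \<Rightarrow> (real \<Rightarrow> real) \<Rightarrow> bool" where
  "multiplicative_on J K \<longleftrightarrow> (\<forall>x\<in>J. \<forall>y\<in>J. x * y \<in> J \<longrightarrow> K (x * y) = K x * K y)"

definition \<phi> :: "real \<Rightarrow> real \<Rightarrow> real" where
  "\<phi> \<alpha> x = (if x = 0 then 0 else \<bar>x\<bar> powr \<alpha>)"

definition \<psi> :: "real \<Rightarrow> real \<Rightarrow> real" where
  "\<psi> \<alpha> x = (if x = 0 then 0 else sgn x * \<bar>x\<bar> powr \<alpha>)"

end

theory Submission
  imports Defs
begin

text \<open>Near \<open>1\<close> the function is positive, so \<open>t \<mapsto> ln (K (exp t))\<close> is additive and measurable near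
  \<open>0\<close>, hence bounded (a Steinhaus-type overlap argument) and therefore linear. This gives
  \<open>K s = s powr \<alpha>\<close> near \<open>1\<close>. Walking from \<open>x\<close> to \<open>r * x\<close> in small multiplicative steps within the
  interval yields \<open>K (r * x) = r powr \<alpha> * K x\<close> for all \<open>r > 0\<close>, so only the sign at a single
  negative point and the value at \<open>0\<close> remain to be determined.\<close>

section \<open>Measurable locally additive functions near 0\<close>

text \<open>The sets where \<bar>f\<bar> \<le> n exhaust the interval, so one of them has nearly
  full measure and must meet each of its small translates. Every small \<open>t\<close> is then a
  difference of two points of that set, which bounds \<open>f t\<close> by 2n.\<close>

lemma locally_additive_measurable_imp_bounded:
  fixes f :: "real \<Rightarrow> real"
  assumes "d > 0"
    and add: "\<And>s t. \<bar>s\<bar> \<le> d \<Longrightarrow> \<bar>t\<bar> \<le> d \<Longrightarrow> \<bar>s + t\<bar> \<le> d \<Longrightarrow> f (s + t) = f s + f t"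
    and meas: "f \<in> borel_measurable (lebesgue_on {-d..d})"
  obtains M where "\<And>t. \<bar>t\<bar> \<le> d / 4 \<Longrightarrow> \<bar>f t\<bar> \<le> M"
proof -
  define E where "E n = {s \<in> {-d..d}. \<bar>f s\<bar> \<le> real n}" for n
  have E_sets: "E n \<in> sets lebesgue" for n
  proof -
    have "{s \<in> space (lebesgue_on {-d..d}). \<bar>f s\<bar> \<le> real n} \<in> sets (lebesgue_on {-d..d})"
      using meas by measurable
    then show ?thesis
      by (simp add: E_def sets_restrict_space_iff)
  qed
  have E_lm: "E n \<in> lmeasurable" for n
    by (rule bounded_set_imp_lmeasurable[OF bounded_subset[of "{-d..d}"] E_sets])
      (auto simp: E_def)
  have "(\<Union>n. E n) = {-d..d}"
    unfolding E_def using real_arch_simple by auto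
  moreover have "(\<lambda>n. measure lebesgue (E n)) \<longlonglongrightarrow> measure lebesgue (\<Union>n. E n)"
  proof (rule Lim_measure_incseq)
    show "range E \<subseteq> sets lebesgue" using E_sets by auto
    show "incseq E" by (fastforce simp: incseq_def E_def)
    show "emeasure lebesgue (\<Union>n. E n) \<noteq> \<infinity>"
      unfolding \<open>(\<Union>n. E n) = {-d..d}\<close> using \<open>d > 0\<close> by simp
  qed
  ultimately have "(\<lambda>n. measure lebesgue (E n)) \<longlonglongrightarrow> 2 * d"
    using \<open>d > 0\<close> by simp
  \<comment> \<open>For \<bar>t\<bar> \<le> d / 4, \<open>E n\<close> and its translate by
    \<open>t\<close> both lie in an interval of length 5 / 2 * d. They overlap once the measure of
    \<open>E n\<close> exceeds half of that, 5 / 4 * d; the value 3 / 2 * d lies between this and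
    the limit 2 * d.\<close>
  moreover have "3 / 2 * d < 2 * d" using \<open>d > 0\<close> by simp
  ultimately have "\<forall>\<^sub>F n in sequentially. 3 / 2 * d < measure lebesgue (E n)"
    by (rule order_tendstoD(1))
  then obtain n where n: "3 / 2 * d < measure lebesgue (E n)"
    by (meson eventually_happens sequentially_bot)
  have "\<bar>f t\<bar> \<le> 2 * real n" if t: "\<bar>t\<bar> \<le> d / 4" for t
  proof -
    let ?T = "(+) t ` E n"
    have T_lm: "?T \<in> lmeasurable" and T_m: "measure lebesgue ?T = measure lebesgue (E n)"
      using E_lm by (simp_all add: measurable_translation measure_translation)
    have "E n \<union> ?T \<subseteq> {- (5 / 4 * d)..5 / 4 * d}"
      using t by (auto simp: E_def)
    then have "measure lebesgue (E n \<union> ?T) \<le> measure lebesgue {- (5 / 4 * d)..5 / 4 * d}"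
      using E_lm T_lm by (intro measure_mono_fmeasurable) auto
    also have "\<dots> = 5 / 2 * d" using \<open>d > 0\<close> by simp
    finally have "measure lebesgue (E n \<inter> ?T) > 0"
      using measure_Un3[OF E_lm[of n] T_lm] n T_m \<open>d > 0\<close> by linarith
    then have "E n \<inter> ?T \<noteq> {}" by auto
    then obtain s where "s \<in> E n" "t + s \<in> E n" by auto
    then show ?thesis
      using add[of t s] t \<open>d > 0\<close> unfolding E_def abs_le_iff by simp
  qed
  then show ?thesis by (rule that)
qed

lemma locally_additive_bounded_imp_linear:
  fixes f :: "real \<Rightarrow> real"
  assumes "d > 0"
    and add: "\<And>s t. \<bar>s\<bar> \<le> d \<Longrightarrow> \<bar>t\<bar> \<le> d \<Longrightarrow> \<bar>s + t\<bar> \<le> d \<Longrightarrow> f (s + t) = f s + f t"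
    and bounded: "\<And>t. \<bar>t\<bar> \<le> d \<Longrightarrow> \<bar>f t\<bar> \<le> M"
  obtains c where "\<And>t. \<bar>t\<bar> \<le> d \<Longrightarrow> f t = c * t"
proof -
  \<comment> \<open>With this slope the remainder \<open>g\<close> vanishes at \<open>d\<close>, so
    shifting by \<open>d\<close> does not change \<open>g\<close> as long as the points stay in the
    domain.\<close>
  define c where "c = f d / d"
  define g where "g t = f t - c * t" for t
  have g_add: "g (s + t) = g s + g t" if "\<bar>s\<bar> \<le> d" "\<bar>t\<bar> \<le> d" "\<bar>s + t\<bar> \<le> d" for s t
    using add[OF that] by (simp add: g_def algebra_simps)
  have "g d = 0" using \<open>d > 0\<close> by (simp add: g_def c_def)
  have "g 0 = 0" using g_add[of 0 0] \<open>d > 0\<close> by simp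
  define B where "B = M + \<bar>c\<bar> * d"
  \<comment> \<open>Since \<open>g d = 0\<close>, doubling modulo \<open>d\<close> maps \<open>{0..d}\<close> to itself and doubles \<open>g\<close>, so a bound for
    \<open>g\<close> can be halved indefinitely.\<close>
  have halve: "\<forall>t\<in>{0..d}. \<bar>g t\<bar> \<le> B / 2 ^ k" for k
  proof (induction k)
    case 0
    show ?case
    proof
      fix t assume t: "t \<in> {0..d}"
      have "\<bar>c * t\<bar> \<le> \<bar>c\<bar> * d"
        using t by (auto simp: abs_mult intro: mult_left_mono)
      moreover have "\<bar>f t\<bar> \<le> M" using t bounded by auto
      ultimately show "\<bar>g t\<bar> \<le> B / 2 ^ 0" by (simp add: g_def B_def)
    qed
  next
    case (Suc k)
    show ?case
    proof
      fix t assume t: "t \<in> {0..d}"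
      have "\<exists>s\<in>{0..d}. g s = 2 * g t"
      proof (cases "t \<le> d / 2")
        case True
        then show ?thesis
          using t g_add[of t t] by (intro bexI[of _ "t + t"]) auto
      next
        case False
        \<comment> \<open>Here \<open>t + t\<close> would leave the domain of additivity, so one
          summand is replaced by \<open>t - d\<close>, where \<open>g\<close> has the same value as
          at \<open>t\<close>.\<close>
        then have "g (t + (t - d)) = g t + g (t - d)" "g ((t - d) + d) = g (t - d) + g d"
          using t by (intro g_add; auto)+
        then show ?thesis
          using False t \<open>g d = 0\<close> by (intro bexI[of _ "t + (t - d)"]) auto
      qed
      then have "\<bar>2 * g t\<bar> \<le> B / 2 ^ k" using Suc by metis
      then show "\<bar>g t\<bar> \<le> B / 2 ^ Suc k" by (simp add: abs_mult field_simps)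
    qed
  qed
  have g_eq_0: "g t = 0" if "t \<in> {0..d}" for t
  proof -
    have "(\<lambda>k. B * (1 / 2) ^ k) \<longlonglongrightarrow> B * 0"
      by (intro tendsto_mult tendsto_const LIMSEQ_power_zero) simp
    moreover have "\<bar>g t\<bar> \<le> B * (1 / 2) ^ k" for k
      using halve[of k] that by (simp add: power_one_over field_simps)
    ultimately have "\<bar>g t\<bar> \<le> B * 0"
      by (intro LIMSEQ_le_const) auto
    then show ?thesis by simp
  qed
  have "f t = c * t" if "\<bar>t\<bar> \<le> d" for t
  proof -
    have "g t + g (- t) = 0"
      using g_add[of t "- t"] that \<open>g 0 = 0\<close> \<open>d > 0\<close> by simp
    then have "g t = 0"
      using g_eq_0[of t] g_eq_0[of "- t"] that by (cases "t \<ge> 0") auto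
    then show ?thesis by (simp add: g_def)
  qed
  then show ?thesis by (rule that)
qed

section \<open>From multiplicativity near 1 to power functions\<close>

text \<open>Composing a Lebesgue measurable function with a continuous one can destroy
  measurability. For \<open>exp\<close> it does not: preimages under \<open>exp\<close> are images
  under \<open>ln\<close>, which is differentiable on the positive reals and so maps Lebesgue sets
  there to Lebesgue sets.\<close>

lemma borel_measurable_lebesgue_on_exp:
  fixes K :: "real \<Rightarrow> real"
  assumes K: "K \<in> borel_measurable (lebesgue_on S)"
    and S: "S \<in> sets lebesgue" and T: "T \<in> sets lebesgue" and sub: "exp ` T \<subseteq> S"
  shows "(\<lambda>t. K (exp t)) \<in> borel_measurable (lebesgue_on T)"
proof (rule borel_measurableI_le)
  fix a
  let ?X = "{x \<in> S. K x \<le> a} \<inter> {0<..}"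
  have "{x \<in> space (lebesgue_on S). K x \<le> a} \<in> sets (lebesgue_on S)"
    using K by measurable
  then have "?X \<in> sets lebesgue"
    using S by (auto simp: sets_restrict_space_iff)
  moreover have "ln differentiable_on ?X"
    by (intro differentiable_at_imp_differentiable_on)
      (auto simp: real_differentiable_def intro: DERIV_ln)
  ultimately have "ln ` ?X \<in> sets lebesgue"
    by (intro differentiable_image_in_sets_lebesgue) auto
  moreover have "{t \<in> T. K (exp t) \<le> a} = ln ` ?X \<inter> T"
  proof
    show "{t \<in> T. K (exp t) \<le> a} \<subseteq> ln ` ?X \<inter> T"
    proof
      fix t assume "t \<in> {t \<in> T. K (exp t) \<le> a}"
      then have "exp t \<in> ?X" "t \<in> T" using sub by auto
      then show "t \<in> ln ` ?X \<inter> T"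
        by (metis IntI image_eqI ln_exp)
    qed
  qed auto
  ultimately show "{t \<in> space (lebesgue_on T). K (exp t) \<le> a} \<in> sets (lebesgue_on T)"
    using T by (simp add: sets_restrict_space_iff sets.Int)
qed

text \<open>The power law is known only for factors near 1, so \<open>r\<close> is split into
  \<open>n\<close> equal factors \<open>exp u\<close> with \<bar>u\<bar> \<le> d. All partial
  products applied to \<open>x\<close> lie between \<open>x\<close> and \<open>r * x\<close>, hence
  in \<open>J\<close>, whatever the sign of \<open>x\<close>.\<close>

lemma multiplicative_on_power_near_1_imp_homogeneous:
  assumes J: "is_interval J" and mult: "multiplicative_on J K"
    and "d > 0" and sub: "exp ` {-d..d} \<subseteq> J"
    and power: "\<And>t. \<bar>t\<bar> \<le> d \<Longrightarrow> K (exp t) = exp (\<alpha> * t)"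
    and "x \<in> J" "r > 0" "r * x \<in> J"
  shows "K (r * x) = r powr \<alpha> * K x"
proof -
  obtain m :: nat where "\<bar>ln r\<bar> / d \<le> real m" using real_arch_simple by blast
  then obtain n :: nat where n: "\<bar>ln r\<bar> / d \<le> real n" "n > 0"
    using that[of "Suc m"] by simp
  define u where "u = ln r / n"
  have u: "\<bar>u\<bar> \<le> d"
    using n \<open>d > 0\<close> by (simp add: u_def field_simps)
  have in_J: "exp (k * u) * x \<in> J" if "k \<le> n" for k :: nat
  proof -
    have "0 \<le> real k / n" "real k / n \<le> 1" using that n by auto
    then have "0 \<le> k * u \<and> k * u \<le> ln r \<or> ln r \<le> k * u \<and> k * u \<le> 0"
      using mult_right_mono[of "real k / n" 1 "ln r"] mult_right_mono_neg[of "real k / n" 1 "ln r"]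
      by (cases "ln r \<ge> 0") (auto simp: u_def mult_nonneg_nonpos divide_nonpos_nonneg)
    then have "1 \<le> exp (k * u) \<and> exp (k * u) \<le> r \<or> r \<le> exp (k * u) \<and> exp (k * u) \<le> 1"
      using \<open>r > 0\<close> by (metis exp_le_cancel_iff exp_ln exp_zero)
    then have "x \<le> exp (k * u) * x \<and> exp (k * u) * x \<le> r * x \<or>
        r * x \<le> exp (k * u) * x \<and> exp (k * u) * x \<le> x"
      using mult_right_mono[of _ _ x] mult_right_mono_neg[of _ _ x]
      by (cases "x \<ge> 0") fastforce+
    then show ?thesis
      using mem_is_interval_1_I[OF J] \<open>x \<in> J\<close> \<open>r * x \<in> J\<close> by blast
  qed
  have "K (exp (k * u) * x) = exp (k * (\<alpha> * u)) * K x" if "k \<le> n" for k :: nat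
    using that
  proof (induction k)
    case (Suc k)
    have "exp u * (exp (k * u) * x) = exp (Suc k * u) * x"
      by (simp add: algebra_simps exp_add)
    moreover have "exp u \<in> J" using u sub by (auto simp: abs_le_iff)
    ultimately have "K (exp (Suc k * u) * x) = K (exp u) * K (exp (k * u) * x)"
      using in_J[OF Suc.prems] in_J[of k] Suc.prems mult
      by (metis Suc_leD multiplicative_on_def)
    with Suc u power show ?case
      by (simp add: algebra_simps exp_add)
  qed simp
  from this[of n] show ?thesis
    using n \<open>r > 0\<close> by (simp add: u_def powr_def mult.commute)
qed

text \<open>Only arguments \<open>exp t\<close> in the interior of \<open>I\<close> occur, so
  measurability on \<open>I\<close> is enough although \<open>K\<close> lives on
  \<open>J\<close>.\<close>

lemma multiplicative_on_measurable_imp_power_near_1: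
  assumes I: "is_interval I" "1 \<in> interior I" "I \<subseteq> J"
    and mult: "multiplicative_on J K" and meas: "K \<in> borel_measurable (lebesgue_on I)"
    and "K 1 = 1"
  obtains d \<alpha> where "d > 0" "exp ` {-d..d} \<subseteq> J" "\<And>t. \<bar>t\<bar> \<le> d \<Longrightarrow> K (exp t) = exp (\<alpha> * t)"
proof -
  have "open (exp -` interior I :: real set)"
    by (intro open_vimage continuous_on_exp continuous_on_id) simp
  moreover have "(0::real) \<in> exp -` interior I" using I by simp
  ultimately obtain d where "d > 0" and d: "cball 0 d \<subseteq> (exp -` interior I :: real set)"
    by (meson open_contains_cball)
  have in_I: "exp t \<in> I" if "\<bar>t\<bar> \<le> d" for t
    using d that interior_subset by fastforce
  have K_add: "K (exp (s + t)) = K (exp s) * K (exp t)"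
    if "\<bar>s\<bar> \<le> d" "\<bar>t\<bar> \<le> d" "\<bar>s + t\<bar> \<le> d" for s t
    using mult in_I that \<open>I \<subseteq> J\<close> unfolding multiplicative_on_def exp_add
    by (metis exp_add subsetD)
  have K_pos: "K (exp t) > 0" if "\<bar>t\<bar> \<le> d" for t
  proof -
    \<comment> \<open>A square is nonnegative, and this one is nonzero because K (exp (t / 2)) times
      K (exp (- t / 2)) equals K 1 = 1.\<close>
    have "K (exp t) = K (exp (t / 2)) ^ 2"
      using K_add[of "t / 2" "t / 2"] that by (simp add: power2_eq_square)
    moreover have "K (exp (t / 2)) \<noteq> 0"
      using K_add[of "t / 2" "- (t / 2)"] that \<open>K 1 = 1\<close> \<open>d > 0\<close> by auto
    ultimately show ?thesis by simp
  qed
  define f where "f t = ln (K (exp t))" for t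
  have f_add: "f (s + t) = f s + f t" if "\<bar>s\<bar> \<le> d" "\<bar>t\<bar> \<le> d" "\<bar>s + t\<bar> \<le> d" for s t
    using K_add[OF that] K_pos[of s] K_pos[of t] that by (simp add: f_def ln_mult)
  have "I \<in> sets lebesgue"
    using real_interval_borel_measurable[OF I(1)] by (auto intro: sets_completionI_sets)
  then have "(\<lambda>t. K (exp t)) \<in> borel_measurable (lebesgue_on {-d..d})"
    using meas in_I by (intro borel_measurable_lebesgue_on_exp[of K I]) (auto simp: abs_le_iff)
  then have "f \<in> borel_measurable (lebesgue_on {-d..d})"
    unfolding f_def by measurable
  \<comment> \<open>The overlap argument bounds \<open>f\<close> only on a quarter of the interval,
    so \<open>d / 4\<close> becomes the final radius.\<close>
  with \<open>d > 0\<close> f_add obtain M where M: "\<And>t. \<bar>t\<bar> \<le> d / 4 \<Longrightarrow> \<bar>f t\<bar> \<le> M"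
    using locally_additive_measurable_imp_bounded[of d f] by metis
  obtain \<alpha> where \<alpha>: "\<And>t. \<bar>t\<bar> \<le> d / 4 \<Longrightarrow> f t = \<alpha> * t"
    by (rule locally_additive_bounded_imp_linear[of "d / 4" f M])
      (use \<open>d > 0\<close> f_add M in auto)
  show ?thesis
  proof (rule that[of "d / 4" \<alpha>])
    show "exp ` {- (d / 4)..d / 4} \<subseteq> J"
      using in_I \<open>I \<subseteq> J\<close> \<open>d > 0\<close> by force
    show "K (exp t) = exp (\<alpha> * t)" if "\<bar>t\<bar> \<le> d / 4" for t
      using \<alpha>[OF that, symmetric] K_pos[of t] that \<open>d > 0\<close> by (simp add: f_def)
  qed (use \<open>d > 0\<close> in simp)
qed

section \<open>The explicit solutions and the equivalence\<close>

lemma \<phi>_mult: "\<phi> \<alpha> (x * y) = \<phi> \<alpha> x * \<phi> \<alpha> y"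
  by (simp add: \<phi>_def abs_mult powr_mult)

lemma \<psi>_mult: "\<psi> \<alpha> (x * y) = \<psi> \<alpha> x * \<psi> \<alpha> y"
  by (simp add: \<psi>_def abs_mult powr_mult sgn_mult)

lemma borel_measurable_\<phi>: "\<phi> \<alpha> \<in> borel_measurable borel"
  unfolding \<phi>_def by measurable

lemma borel_measurable_\<psi>: "\<psi> \<alpha> \<in> borel_measurable borel"
  unfolding \<psi>_def by measurable

lemma multiplicative_measurable_transfer:
  assumes "\<forall>x\<in>J. K x = g x" "I \<subseteq> J" "\<And>x y. g (x * y) = g x * g y" "g \<in> borel_measurable borel"
  shows "multiplicative_on J K \<and> K \<in> borel_measurable (lebesgue_on I)"
proof
  show "multiplicative_on J K" using assms by (simp add: multiplicative_on_def)
  have "g \<in> borel_measurable (lebesgue_on I)"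
    using assms(4) by (intro measurable_restrict_space1 measurable_completion) simp
  moreover have "g \<in> borel_measurable (lebesgue_on I) \<longleftrightarrow> K \<in> borel_measurable (lebesgue_on I)"
    using assms(1,2) by (intro measurable_cong) auto
  ultimately show "K \<in> borel_measurable (lebesgue_on I)" by simp
qed

theorem corollary3:
  fixes I J :: "real set" and K :: "real \<Rightarrow> real"
  assumes "is_interval I" and "is_interval J" and "I \<subseteq> J"
    and "1 \<in> interior I" and "1 \<in> interior J"
    and "\<exists>x\<in>J. K x \<noteq> 0"
  shows "(multiplicative_on J K \<and> K \<in> borel_measurable (lebesgue_on I)) \<longleftrightarrow>
    ((\<forall>x\<in>J. K x = 1) \<or> (\<exists>\<alpha>. (\<forall>x\<in>J. K x = \<phi> \<alpha> x) \<or> (\<forall>x\<in>J. K x = \<psi> \<alpha> x)))"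
    (is "?L \<longleftrightarrow> ?R")
proof
  assume ?R
  then consider "\<forall>x\<in>J. K x = 1" | \<alpha> where "\<forall>x\<in>J. K x = \<phi> \<alpha> x" | \<alpha> where "\<forall>x\<in>J. K x = \<psi> \<alpha> x"
    by blast
  then show ?L
  proof cases
    case 1
    then show ?thesis
      by (rule multiplicative_measurable_transfer) (use assms in auto)
  next
    case 2
    then show ?thesis
      by (rule multiplicative_measurable_transfer)
        (use assms \<phi>_mult borel_measurable_\<phi> in auto)
  next
    case 3
    then show ?thesis
      by (rule multiplicative_measurable_transfer)
        (use assms \<psi>_mult borel_measurable_\<psi> in auto)
  qed
next
  assume L: ?L
  then have K_mult: "K (x * y) = K x * K y" if "x \<in> J" "y \<in> J" "x * y \<in> J" for x y
    using that by (simp add: multiplicative_on_def)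
  have "1 \<in> J" using assms(5) interior_subset by auto
  obtain z where "z \<in> J" "K z \<noteq> 0" using assms(6) by blast
  then have "K 1 = 1" using K_mult[of z 1] \<open>1 \<in> J\<close> by simp
  obtain d \<alpha> where "d > 0" "exp ` {-d..d} \<subseteq> J" "\<And>t. \<bar>t\<bar> \<le> d \<Longrightarrow> K (exp t) = exp (\<alpha> * t)"
    using multiplicative_on_measurable_imp_power_near_1[OF assms(1,4,3)] L \<open>K 1 = 1\<close> by metis
  then have homog: "K (r * x) = r powr \<alpha> * K x" if "x \<in> J" "r > 0" "r * x \<in> J" for r x
    using multiplicative_on_power_near_1_imp_homogeneous[OF assms(2), of K d \<alpha> x r] L that by blast
  have pos: "K x = x powr \<alpha>" if "x \<in> J" "x > 0" for x
    using homog[of 1 x] that \<open>1 \<in> J\<close> \<open>K 1 = 1\<close> by simp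
  show ?R
  proof (cases "0 \<in> J \<and> K 0 \<noteq> 0")
    case True
    \<comment> \<open>K 0 = K 0 * K x for every \<open>x\<close> in \<open>J\<close>, and K 0 can be
      cancelled.\<close>
    then have "K x = 1" if "x \<in> J" for x
      using K_mult[of 0 x] that by simp
    then show ?thesis by blast
  next
    case False
    then have zero: "K 0 = 0" if "0 \<in> J" using that by blast
    show ?thesis
    proof (cases "\<exists>a\<in>J. a < 0")
      case True
      then obtain a where "a \<in> J" "a < 0" by blast
      \<comment> \<open>The square of \<open>a\<close> may lie outside \<open>J\<close>. Moving
        \<open>a\<close> into [-1, 0) gives b \<le> b * b \<le> 1, so that \<open>b * b\<close>
        stays in \<open>J\<close> and K b is a square root of a known value.\<close>
      define b where "b = max a (- 1)"
      have b: "b < 0" "- 1 \<le> b" "a \<le> b" using \<open>a < 0\<close> by (auto simp: b_def)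
      have "b \<in> J"
        by (rule mem_is_interval_1_I[OF assms(2) \<open>a \<in> J\<close> \<open>1 \<in> J\<close>]) (use b in auto)
      have "b * b \<le> 1" using b by (simp add: abs_square_le_1 flip: power2_eq_square)
      have "b * b \<in> J"
        by (rule mem_is_interval_1_I[OF assms(2) \<open>b \<in> J\<close> \<open>1 \<in> J\<close>])
          (use b \<open>b * b \<le> 1\<close> order_trans[of b 0 "b * b"] in auto)
      have "K b * K b = (b * b) powr \<alpha>"
        using K_mult[of b b] pos[of "b * b"] \<open>b \<in> J\<close> \<open>b * b \<in> J\<close> b by (simp add: mult_neg_neg)
      also have "\<dots> = ((- b) * (- b)) powr \<alpha>" by simp
      also have "\<dots> = (- b) powr \<alpha> * (- b) powr \<alpha>"
        using b by (subst powr_mult) auto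
      finally have K_b: "K b = (- b) powr \<alpha> \<or> K b = - ((- b) powr \<alpha>)"
        by (simp add: square_eq_iff)
      \<comment> \<open>The ratio \<open>x / b\<close> is positive, so homogeneity carries the sign
        of K b to all negative points: plus leads to \<phi>, minus to \<psi>.\<close>
      have neg: "K x = (x / b) powr \<alpha> * K b" if "x \<in> J" "x < 0" for x
        using homog[of b "x / b"] that \<open>b \<in> J\<close> b by (simp add: divide_neg_neg)
      have scale: "(x / b) powr \<alpha> * (- b) powr \<alpha> = (- x) powr \<alpha>" if "x < 0" for x
      proof -
        have "(x / b) powr \<alpha> * (- b) powr \<alpha> = (x / b * (- b)) powr \<alpha>"
          using that b by (subst powr_mult) (auto intro: divide_nonpos_nonpos)
        then show ?thesis using b by simp
      qed
      from K_b show ?thesis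
      proof
        assume *: "K b = (- b) powr \<alpha>"
        have "K x = \<phi> \<alpha> x" if "x \<in> J" for x
          using zero pos neg scale * that by (cases x "0 :: real" rule: linorder_cases) (auto simp: \<phi>_def)
        then show ?thesis by blast
      next
        assume *: "K b = - ((- b) powr \<alpha>)"
        have "K x = \<psi> \<alpha> x" if "x \<in> J" for x
          using zero pos neg scale * that by (cases x "0 :: real" rule: linorder_cases) (auto simp: \<psi>_def)
        then show ?thesis by blast
      qed
    next
      case False
      \<comment> \<open>Without negative points in \<open>J\<close>, \<phi> and \<psi> agree there,
        so either could be named.\<close>
      have "K x = \<phi> \<alpha> x" if "x \<in> J" for x
        using zero pos False that by (cases x "0 :: real" rule: linorder_cases) (auto simp: \<phi>_def)
      then show ?thesis by blast
    qed
  qed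
qed

end
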